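(* Let $A$ and $B$ be invertible positive operators on a Hilbert space $\mathscr{H}$ such that $A\le B$, and let $p\in(0,1]$. Then $$A^{\frac12}\left(\frac{A^{-\frac12}BA^{-\frac12}+I}{2}\right)^{p-1}\left(A^{-\frac12}BA^{-\frac12}-I\right)A^{\frac12}\;\le\; T_p(A|B)\;\le\;\frac12\left(A\#_pB-A\natural_{p-1}B+B-A\right).$$
   Context: Operators are bounded linear operators on a Hilbert space $\mathscr{H}$, $I$ is the identity operator, and $X\le Y$ denotes the usual (Loewner) order on self-adjoint operators, i.e. $Y-X$ is positive (positive semidefinite). For invertible positive operators $A,B$ and $r\in\mathbb{R}$, define $A\natural_r B:=A^{\frac12}\left(A^{-\frac12}BA^{-\frac12}\right)^{r}A^{\frac12}$; for $r=p\in[0,1]$ this is written $A\#_pB$. For $p\in(0,1]$, the Tsallis relative operator entropy is $T_p(A|B):=\dfrac{A\#_pB-A}{p}$. *)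

theory Defs
  imports "HOL-Analysis.Analysis" "HOL-Computational_Algebra.Polynomial"
begin

class complex_vector = real_vector +
  fixes scaleC :: "complex \<Rightarrow> 'a \<Rightarrow> 'a"  (infixr "*\<^sub>C" 75)
  assumes scaleC_add_right: "c *\<^sub>C (x + y) = c *\<^sub>C x + c *\<^sub>C y"
    and scaleC_add_left: "(c + d) *\<^sub>C x = c *\<^sub>C x + d *\<^sub>C x"
    and scaleC_scaleC: "c *\<^sub>C d *\<^sub>C x = (c * d) *\<^sub>C x"
    and scaleC_of_real: "complex_of_real r *\<^sub>C x = r *\<^sub>R x"

text \<open>The inner product is linear in its first argument. The last axiom says that the norm is
  the one induced by the inner product; it contains positivity and definiteness.\<close>

class complex_inner = complex_vector + real_normed_vector +
  fixes cinner :: "'a \<Rightarrow> 'a \<Rightarrow> complex"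
  assumes cinner_commute: "cinner x y = cnj (cinner y x)"
    and cinner_add_left: "cinner (x + y) z = cinner x z + cinner y z"
    and cinner_scaleC_left: "cinner (c *\<^sub>C x) y = c * cinner x y"
    and cinner_self: "cinner x x = complex_of_real ((norm x)\<^sup>2)"

class chilbert_space = complex_inner + banach

instantiation complex :: chilbert_space
begin

definition scaleC_complex :: "complex \<Rightarrow> complex \<Rightarrow> complex"
  where "scaleC_complex c x = c * x"

definition cinner_complex :: "complex \<Rightarrow> complex \<Rightarrow> complex"
  where "cinner_complex x y = x * cnj y"

instance
proof
  fix x :: complex
  show "cinner x x = complex_of_real ((norm x)\<^sup>2)"
    by (simp only: cinner_complex_def complex_norm_square)
qed (simp_all add: scaleC_complex_def cinner_complex_def algebra_simps scaleR_conv_of_real)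

end

lemma norm_scaleC: "norm (c *\<^sub>C x) = cmod c * norm (x :: 'a::complex_inner)"
proof -
  have "complex_of_real ((norm (c *\<^sub>C x))\<^sup>2) = c * cinner x (c *\<^sub>C x)"
    by (simp only: cinner_self[symmetric] cinner_scaleC_left)
  also have "cinner x (c *\<^sub>C x) = cnj c * cinner x x"
    by (metis cinner_commute cinner_scaleC_left complex_cnj_mult)
  also have "c * (cnj c * cinner x x) = complex_of_real ((cmod c * norm x)\<^sup>2)"
    by (simp only: cinner_self power_mult_distrib of_real_mult complex_norm_square[of c] mult.assoc)
  finally have "(norm (c *\<^sub>C x))\<^sup>2 = (cmod c * norm x)\<^sup>2"
    by (simp only: of_real_eq_iff)
  then show ?thesis
    by (simp add: power2_eq_iff_nonneg)
qed

lemma bounded_linear_scaleC: "bounded_linear (\<lambda>x :: 'a::complex_inner. c *\<^sub>C x)"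
proof (rule bounded_linear_intro)
  fix x y :: 'a and r :: real
  show "c *\<^sub>C (x + y) = c *\<^sub>C x + c *\<^sub>C y"
    by (rule scaleC_add_right)
  show "c *\<^sub>C r *\<^sub>R x = r *\<^sub>R c *\<^sub>C x"
    by (simp add: scaleC_scaleC mult.commute flip: scaleC_of_real)
  show "norm (c *\<^sub>C x) \<le> norm x * cmod c"
    by (simp add: norm_scaleC mult.commute)
qed

lift_definition scalar_op :: "complex \<Rightarrow> 'a::complex_inner \<Rightarrow>\<^sub>L 'a"
  is "\<lambda>c x. c *\<^sub>C x"
  by (rule bounded_linear_scaleC)

text \<open>The type of bounded operators is that of bounded \<^emph>\<open>real\<close>-linear maps, so complex-linearity
  is a separate condition. The inverse of a complex-linear map is complex-linear, so none is
  needed in \<open>invertible_op\<close>.\<close>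

definition complex_linear_op :: "('a::complex_inner \<Rightarrow>\<^sub>L 'a) \<Rightarrow> bool"
  where "complex_linear_op T \<longleftrightarrow> (\<forall>c x. blinfun_apply T (c *\<^sub>C x) = c *\<^sub>C blinfun_apply T x)"

definition selfadjoint_op :: "('a::complex_inner \<Rightarrow>\<^sub>L 'a) \<Rightarrow> bool"
  where "selfadjoint_op T \<longleftrightarrow> complex_linear_op T \<and>
    (\<forall>x y. cinner (blinfun_apply T x) y = cinner x (blinfun_apply T y))"

definition positive_op :: "('a::complex_inner \<Rightarrow>\<^sub>L 'a) \<Rightarrow> bool"
  where "positive_op T \<longleftrightarrow> selfadjoint_op T \<and> (\<forall>x. 0 \<le> Re (cinner (blinfun_apply T x) x))"

definition invertible_op :: "('a::real_normed_vector \<Rightarrow>\<^sub>L 'a) \<Rightarrow> bool"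
  where "invertible_op T \<longleftrightarrow> (\<exists>S. S o\<^sub>L T = id_blinfun \<and> T o\<^sub>L S = id_blinfun)"

definition loewner_le :: "('a::complex_inner \<Rightarrow>\<^sub>L 'a) \<Rightarrow> ('a \<Rightarrow>\<^sub>L 'a) \<Rightarrow> bool"  (infix "\<preceq>" 50)
  where "X \<preceq> Y \<longleftrightarrow> selfadjoint_op X \<and> selfadjoint_op Y \<and> positive_op (Y - X)"

definition spectrum_op :: "('a::complex_inner \<Rightarrow>\<^sub>L 'a) \<Rightarrow> complex set"
  where "spectrum_op T = {c. \<not> invertible_op (T - scalar_op c)}"

definition poly_op :: "real poly \<Rightarrow> ('a::real_normed_vector \<Rightarrow>\<^sub>L 'a) \<Rightarrow> 'a \<Rightarrow>\<^sub>L 'a"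
  where "poly_op q T = (\<Sum>i\<le>degree q. coeff q i *\<^sub>R (((o\<^sub>L) T ^^ i) id_blinfun))"

text \<open>Continuous functional calculus: \<open>f(T)\<close> is the norm limit of \<open>q\<^sub>n(T)\<close> for real polynomials
  \<open>q\<^sub>n\<close> converging to \<open>f\<close> uniformly on the spectrum of \<open>T\<close>. It is meaningful for self-adjoint
  \<open>T\<close> on a Hilbert space (whose spectrum is real) and \<open>f\<close> continuous on the spectrum.\<close>

definition fun_calc :: "(real \<Rightarrow> real) \<Rightarrow> ('a::complex_inner \<Rightarrow>\<^sub>L 'a) \<Rightarrow> 'a \<Rightarrow>\<^sub>L 'a"
  where "fun_calc f T = (THE S. \<exists>q :: nat \<Rightarrow> real poly.
    uniform_limit {t. complex_of_real t \<in> spectrum_op T} (\<lambda>n. poly (q n)) f sequentially \<and>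
    (\<lambda>n. poly_op (q n) T) \<longlonglongrightarrow> S)"

text \<open>Real powers, meant for positive invertible operators: their spectrum is a compact subset of
  the open half-line \<open>t > 0\<close>, where \<open>t powr r\<close> is continuous for every real \<open>r\<close>.\<close>

definition powr_op :: "('a::complex_inner \<Rightarrow>\<^sub>L 'a) \<Rightarrow> real \<Rightarrow> 'a \<Rightarrow>\<^sub>L 'a"  (infixr "powr\<^sub>L" 80)
  where "T powr\<^sub>L r = fun_calc (\<lambda>t. t powr r) T"

definition natural_op :: "real \<Rightarrow> ('a::complex_inner \<Rightarrow>\<^sub>L 'a) \<Rightarrow> ('a \<Rightarrow>\<^sub>L 'a) \<Rightarrow> 'a \<Rightarrow>\<^sub>L 'a"
  where "natural_op r A B =
    A powr\<^sub>L (1/2) o\<^sub>L (A powr\<^sub>L (-1/2) o\<^sub>L B o\<^sub>L A powr\<^sub>L (-1/2)) powr\<^sub>L r o\<^sub>L A powr\<^sub>L (1/2)"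

abbreviation (input) geometric_mean_op ::
    "real \<Rightarrow> ('a::complex_inner \<Rightarrow>\<^sub>L 'a) \<Rightarrow> ('a \<Rightarrow>\<^sub>L 'a) \<Rightarrow> 'a \<Rightarrow>\<^sub>L 'a"
  where "geometric_mean_op p A B \<equiv> natural_op p A B"

definition tsallis_op :: "real \<Rightarrow> ('a::complex_inner \<Rightarrow>\<^sub>L 'a) \<Rightarrow> ('a \<Rightarrow>\<^sub>L 'a) \<Rightarrow> 'a \<Rightarrow>\<^sub>L 'a"
  where "tsallis_op p A B = (1 / p) *\<^sub>R (geometric_mean_op p A B - A)"

end

theory Submission
  imports Defs "HOL-Computational_Algebra.Fundamental_Theorem_Algebra"
begin

text \<open>Put \<open>C = A powr (-1/2) B A powr (-1/2)\<close>; then \<open>A \<le> B\<close> gives \<open>I \<le> C\<close>, so the spectrum of \<open>C\<close> lies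
  in \<open>[1, \<infinity>)\<close>. All three operators are of the form \<open>A powr (1/2) f(C) A powr (1/2)\<close>, and the
  functions \<open>f\<close> are ordered on \<open>[1, \<infinity>)\<close> by the Hermite--Hadamard inequalities for
  \<open>\<integral>\<^sub>1\<^sup>t s powr (p - 1) ds = (t powr p - 1) / p\<close>.
  It remains that the functional calculus of a self-adjoint \<open>T\<close> is well defined, multiplicative and
  monotone. This reduces to: a real polynomial \<open>q\<close> that is nonnegative on the spectrum has
  \<open>q(T) \<ge> 0\<close>. To see it, factor a polynomial without roots in the spectrum into real linear and
  definite quadratic factors, each of which becomes invertible at \<open>T\<close>; and note that a positive
  operator is invertible iff it is coercive.\<close>


subsection \<open>The real inner product\<close>

text \<open>Real-valued and symmetric, so quadratic forms can be compared by \<le> and the usual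
  real Hilbert space arguments run without conjugates.\<close>

definition rinner :: "'a::complex_inner \<Rightarrow> 'a \<Rightarrow> real"
  where "rinner x y = Re (cinner x y)"

lemma rinner_commute: "rinner x y = rinner y x"
  unfolding rinner_def by (subst cinner_commute) simp

lemma rinner_add_left: "rinner (x + y) z = rinner x z + rinner y z"
  by (simp add: rinner_def cinner_add_left)

lemma rinner_scaleR_left: "rinner (r *\<^sub>R x) y = r * rinner x y"
  by (simp add: rinner_def cinner_scaleC_left flip: scaleC_of_real)

lemma rinner_add_right: "rinner z (x + y) = rinner z x + rinner z y"
  by (metis rinner_add_left rinner_commute)

lemma rinner_scaleR_right: "rinner y (r *\<^sub>R x) = r * rinner y x"
  by (metis rinner_scaleR_left rinner_commute)

lemma rinner_self: "rinner x x = (norm x)\<^sup>2"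
  by (simp add: rinner_def cinner_self)

lemma norm_add_scaleR_sq: "(norm (x + t *\<^sub>R y))\<^sup>2 = (norm x)\<^sup>2 + 2 * t * rinner x y + t\<^sup>2 * (norm y)\<^sup>2"
  unfolding rinner_self[symmetric]
  by (simp add: rinner_add_left rinner_add_right rinner_scaleR_left rinner_scaleR_right
      rinner_commute[of y x] power2_eq_square algebra_simps)

lemma abs_rinner_le: "\<bar>rinner x y\<bar> \<le> norm x * norm y"
proof (cases "y = 0")
  case True
  then show ?thesis using rinner_scaleR_right[of x 0 0] by simp
next
  case False
  \<comment> \<open>The minimiser over real t of the norm of x + t y; nonnegativity of the minimum
    is the Cauchy-Schwarz inequality.\<close>
  let ?t = "- rinner x y / (norm y)\<^sup>2"
  have "0 \<le> (norm x)\<^sup>2 + 2 * ?t * rinner x y + ?t\<^sup>2 * (norm y)\<^sup>2"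
    by (metis norm_add_scaleR_sq zero_le_power2)
  also have "\<dots> = (norm x)\<^sup>2 - (rinner x y)\<^sup>2 / (norm y)\<^sup>2"
    using False by (simp add: field_simps power2_eq_square)
  finally have "(rinner x y)\<^sup>2 \<le> (norm x * norm y)\<^sup>2"
    using False by (simp add: field_simps power_mult_distrib)
  then show ?thesis
    by (metis abs_le_square_iff abs_mult abs_norm_cancel)
qed

lemma bounded_bilinear_rinner: "bounded_bilinear rinner"
proof
  show "\<exists>K. \<forall>a b. norm (rinner a b) \<le> norm a * norm b * K"
    by (rule exI[of _ 1]) (simp add: abs_rinner_le)
qed (simp_all add: rinner_add_left rinner_add_right rinner_scaleR_left rinner_scaleR_right)

interpretation rinner: bounded_bilinear rinner
  by (rule bounded_bilinear_rinner)

lemma rinner_blinfun_le: "rinner (blinfun_apply T x) x \<le> norm T * (norm x)\<^sup>2"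
proof -
  have "rinner (T x) x \<le> norm (T x) * norm x"
    using abs_rinner_le[of "T x" x] by simp
  also have "\<dots> \<le> norm T * norm x * norm x"
    by (simp add: mult_right_mono norm_blinfun)
  finally show ?thesis by (simp add: power2_eq_square mult.assoc)
qed

subsection \<open>Self-adjoint operators\<close>

interpretation blinfun_compose: bounded_bilinear "(o\<^sub>L)"
  by (rule bounded_bilinear_blinfun_compose)

lemma blinfun_compose_id [simp]: "id_blinfun o\<^sub>L T = T" "T o\<^sub>L id_blinfun = T"
  by (auto intro: blinfun_eqI)

lemma scaleC_scaleR: "c *\<^sub>C (r *\<^sub>R x) = r *\<^sub>R (c *\<^sub>C (x :: 'a::complex_vector))"
  by (simp add: scaleC_scaleC mult.commute flip: scaleC_of_real)

text \<open>Polarization by \<open>\<i>\<close> recovers the imaginary part of the inner product, so for complex-linear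
  operators symmetry may be tested on real parts.\<close>

lemma selfadjoint_opI:
  assumes "complex_linear_op T" "\<And>x y. rinner (T x) y = rinner x (T y)"
  shows "selfadjoint_op T"
  unfolding selfadjoint_op_def
proof (intro conjI allI complex_eqI)
  fix x y
  show "Re (cinner (T x) y) = Re (cinner x (T y))"
    using assms(2) by (simp add: rinner_def)
  have "Im (cinner u v) = rinner ((- \<i>) *\<^sub>C u) v" for u v :: 'a
    by (simp add: rinner_def cinner_scaleC_left)
  then show "Im (cinner (T x) y) = Im (cinner x (T y))"
    using assms by (metis complex_linear_op_def)
qed (use assms in auto)

lemma selfadjoint_op_rinner: "selfadjoint_op T \<Longrightarrow> rinner (T x) y = rinner x (T y)"
  by (simp add: selfadjoint_op_def rinner_def)

lemma positive_op_iff: "positive_op T \<longleftrightarrow> selfadjoint_op T \<and> (\<forall>x. 0 \<le> rinner (T x) x)"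
  by (simp add: positive_op_def rinner_def)

lemma complex_linear_opD: "complex_linear_op T \<Longrightarrow> blinfun_apply T (c *\<^sub>C x) = c *\<^sub>C T x"
  by (simp add: complex_linear_op_def)

lemma selfadjoint_complex_linear: "selfadjoint_op T \<Longrightarrow> complex_linear_op T"
  by (simp add: selfadjoint_op_def)

lemma selfadjoint_op_id: "selfadjoint_op id_blinfun"
  by (simp add: selfadjoint_op_def complex_linear_op_def)

lemma selfadjoint_op_zero: "selfadjoint_op 0"
  by (rule selfadjoint_opI)
    (simp_all add: complex_linear_op_def blinfun.bilinear_simps rinner.zero_left rinner.zero_right
      norm_scaleC flip: norm_eq_zero)

lemma selfadjoint_op_add:
  assumes "selfadjoint_op S" "selfadjoint_op T"
  shows "selfadjoint_op (S + T)"
  using assms assms[THEN selfadjoint_complex_linear] by (intro selfadjoint_opI)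
    (auto simp: complex_linear_op_def blinfun.bilinear_simps rinner_add_left rinner_add_right
      selfadjoint_op_rinner scaleC_add_right)

lemma selfadjoint_op_scaleR:
  assumes "selfadjoint_op S"
  shows "selfadjoint_op (r *\<^sub>R S)"
  using assms assms[THEN selfadjoint_complex_linear] by (intro selfadjoint_opI)
    (auto simp: complex_linear_op_def blinfun.bilinear_simps rinner_scaleR_left rinner_scaleR_right
      selfadjoint_op_rinner scaleC_scaleR)

lemma selfadjoint_op_compose_commute:
  assumes "selfadjoint_op S" "selfadjoint_op T" "S o\<^sub>L T = T o\<^sub>L S"
  shows "selfadjoint_op (S o\<^sub>L T)"
proof (rule selfadjoint_opI)
  show "complex_linear_op (S o\<^sub>L T)"
    using assms(1,2)[THEN selfadjoint_complex_linear] by (simp add: complex_linear_op_def)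
  fix x y
  show "rinner ((S o\<^sub>L T) x) y = rinner x ((S o\<^sub>L T) y)"
    \<comment> \<open>Only the right-hand side is rewritten, since moving the factors across one at
      a time reverses their order.\<close>
    by (subst (2) assms(3)) (simp add: assms(1,2) selfadjoint_op_rinner)
qed

lemma selfadjoint_op_sandwich:
  assumes "selfadjoint_op S" "selfadjoint_op T"
  shows "selfadjoint_op (S o\<^sub>L T o\<^sub>L S)"
  using assms assms[THEN selfadjoint_complex_linear] by (intro selfadjoint_opI)
    (auto simp: complex_linear_op_def selfadjoint_op_rinner)

lemma blinfun_compose_assoc: "(R o\<^sub>L S) o\<^sub>L T = R o\<^sub>L (S o\<^sub>L T)"
  by (rule blinfun_eqI) simp

lemma tendsto_blinfun_apply:
  assumes "(Q \<longlongrightarrow> S) F"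
  shows "((\<lambda>n. blinfun_apply (Q n) x) \<longlongrightarrow> S x) F"
  using assms by (intro blinfun.tendsto tendsto_const)

lemma selfadjoint_op_tendsto:
  assumes "\<And>n. selfadjoint_op (Q n)" "Q \<longlonglongrightarrow> S"
  shows "selfadjoint_op S"
proof (rule selfadjoint_opI)
  note lim = tendsto_blinfun_apply[OF assms(2)]
  show "complex_linear_op S"
    unfolding complex_linear_op_def
  proof (intro allI)
    fix c x
    have "(\<lambda>n. c *\<^sub>C Q n x) \<longlonglongrightarrow> c *\<^sub>C S x"
      using bounded_linear.tendsto[OF bounded_linear_scaleC lim] .
    moreover have "(\<lambda>n. c *\<^sub>C Q n x) = (\<lambda>n. Q n (c *\<^sub>C x))"
      using assms(1) by (simp add: complex_linear_opD selfadjoint_complex_linear)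
    ultimately show "S (c *\<^sub>C x) = c *\<^sub>C S x"
      using lim[of "c *\<^sub>C x"] LIMSEQ_unique by metis
  qed
  fix x y
  have "(\<lambda>n. rinner (Q n x) y) \<longlonglongrightarrow> rinner (S x) y"
    "(\<lambda>n. rinner x (Q n y)) \<longlonglongrightarrow> rinner x (S y)"
    by (intro rinner.tendsto lim tendsto_const)+
  then show "rinner (S x) y = rinner x (S y)"
    unfolding selfadjoint_op_rinner[OF assms(1)] by (rule LIMSEQ_unique)
qed

lemma positive_op_sandwich:
  assumes "selfadjoint_op S" "positive_op T"
  shows "positive_op (S o\<^sub>L T o\<^sub>L S)"
  using assms by (auto simp: positive_op_iff selfadjoint_op_sandwich)
    (metis selfadjoint_op_rinner)

subsection \<open>Coercive operators and the spectrum\<close>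

lemma invertible_op_compose:
  assumes "invertible_op S" "invertible_op T"
  shows "invertible_op (S o\<^sub>L T)"
proof -
  obtain S' T' where "S' o\<^sub>L S = id_blinfun" "S o\<^sub>L S' = id_blinfun"
    "T' o\<^sub>L T = id_blinfun" "T o\<^sub>L T' = id_blinfun"
    using assms by (auto simp: invertible_op_def)
  then have *: "S' (S x) = x" "S (S' x) = x" "T' (T x) = x" "T (T' x) = x" for x
    by (metis blinfun_apply_blinfun_compose blinfun_apply_id_blinfun)+
  show ?thesis
    unfolding invertible_op_def
    by (rule exI[of _ "T' o\<^sub>L S'"]) (auto intro!: blinfun_eqI simp: *)
qed

lemma invertible_op_scaleR:
  assumes "invertible_op S" "r \<noteq> 0"
  shows "invertible_op (r *\<^sub>R S)"
proof -
  obtain S' where "S' o\<^sub>L S = id_blinfun" "S o\<^sub>L S' = id_blinfun"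
    using assms by (auto simp: invertible_op_def)
  then show ?thesis
    unfolding invertible_op_def using assms(2)
    by (intro exI[of _ "inverse r *\<^sub>R S'"])
      (simp add: blinfun_compose.scaleR_left blinfun_compose.scaleR_right)
qed

lemma invertible_op_id: "invertible_op id_blinfun"
  unfolding invertible_op_def by (rule exI[of _ id_blinfun]) simp

text \<open>For \<open>S\<close> coercive and \<open>\<tau>\<close> small, \<open>x - \<tau> (S x - y)\<close> is a contraction in \<open>x\<close>;
  its fixed point solves \<open>S x = y\<close>.\<close>

lemma invertible_op_coercive:
  fixes S :: "'a::chilbert_space \<Rightarrow>\<^sub>L 'a"
  assumes "0 < c" and coercive: "\<And>x. c * (norm x)\<^sup>2 \<le> rinner (S x) x"
  shows "invertible_op S"
proof -
  \<comment> \<open>The summand \<open>c\<close> secures \<open>c \<le> K\<close> even on the zero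
    space, where coercivity gives no lower bound on \<open>norm S\<close>.\<close>
  define K where "K = norm S + c"
  have K: "0 < K" "c \<le> K" and norm_S: "norm (S x) \<le> K * norm x" for x
    using \<open>0 < c\<close> norm_blinfun[of S x]
    by (auto simp: K_def intro: add_nonneg_pos) (simp add: distrib_right add_increasing2)
  have lower: "c * norm x \<le> norm (S x)" for x
  proof (cases "x = 0")
    case False
    have "c * norm x * norm x \<le> norm (S x) * norm x"
      using coercive[of x] abs_rinner_le[of "S x" x] by (simp add: power2_eq_square)
    then show ?thesis using False by simp
  qed simp
  \<comment> \<open>This step size minimises
    \<open>1 - 2 * \<tau> * c + \<tau>\<^sup>2 * K\<^sup>2\<close>, the bound on the squared
    contraction factor; the minimum is \<open>\<kappa>\<^sup>2\<close>.\<close>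
  define \<tau> where "\<tau> = c / K\<^sup>2"
  define \<kappa> where "\<kappa> = sqrt (1 - c\<^sup>2 / K\<^sup>2)"
  have le1: "c\<^sup>2 / K\<^sup>2 \<le> 1"
    using K \<open>0 < c\<close> by (simp add: power_mono)
  have \<kappa>: "0 \<le> \<kappa>" "\<kappa> < 1" "\<kappa>\<^sup>2 = 1 - c\<^sup>2 / K\<^sup>2"
    using le1 K \<open>0 < c\<close> by (auto simp: \<kappa>_def)
  have contr: "norm (x - \<tau> *\<^sub>R S x) \<le> \<kappa> * norm x" for x
  proof (rule power2_le_imp_le)
    have "(norm (x - \<tau> *\<^sub>R S x))\<^sup>2 = (norm x)\<^sup>2 - 2 * \<tau> * rinner (S x) x + \<tau>\<^sup>2 * (norm (S x))\<^sup>2"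
      using norm_add_scaleR_sq[of x "- \<tau>" "S x"] by (simp add: rinner_commute)
    also have "\<dots> \<le> (norm x)\<^sup>2 - 2 * \<tau> * (c * (norm x)\<^sup>2) + \<tau>\<^sup>2 * (K * norm x)\<^sup>2"
      using K \<open>0 < c\<close>
      by (intro add_mono diff_mono mult_left_mono coercive power_mono norm_S) (auto simp: \<tau>_def)
    also have "\<dots> = (\<kappa> * norm x)\<^sup>2"
      unfolding power_mult_distrib \<kappa>(3) using K
      by (simp add: \<tau>_def field_simps power2_eq_square)
    finally show "(norm (x - \<tau> *\<^sub>R S x))\<^sup>2 \<le> (\<kappa> * norm x)\<^sup>2" .
  qed (use \<kappa> in simp)
  have "\<exists>x. S x = y" for y
  proof -
    have "\<exists>!x. x - \<tau> *\<^sub>R (S x - y) = x"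
    proof (rule banach_fix_type[OF \<kappa>(1,2)])
      show "\<forall>x z. dist (x - \<tau> *\<^sub>R (S x - y)) (z - \<tau> *\<^sub>R (S z - y)) \<le> \<kappa> * dist x z"
      proof (intro allI)
        fix x z
        have "(x - \<tau> *\<^sub>R (S x - y)) - (z - \<tau> *\<^sub>R (S z - y)) = (x - z) - \<tau> *\<^sub>R S (x - z)"
          by (simp add: blinfun.bilinear_simps algebra_simps)
        then show "dist (x - \<tau> *\<^sub>R (S x - y)) (z - \<tau> *\<^sub>R (S z - y)) \<le> \<kappa> * dist x z"
          using contr[of "x - z"] by (simp only: dist_norm)
      qed
    qed
    then obtain x where "\<tau> *\<^sub>R (S x - y) = 0" by auto
    then show ?thesis using K \<open>0 < c\<close> by (auto simp: \<tau>_def)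
  qed
  then obtain R where R: "S (R y) = y" for y by metis
  have inj: "x = z" if "S x = S z" for x z
    using lower[of "x - z"] that \<open>0 < c\<close> by (simp add: blinfun.bilinear_simps mult_le_0_iff)
  \<comment> \<open>\<open>R\<close> is a pointwise choice of preimages: linearity follows by
    applying \<open>S\<close> and cancelling, the bound from the lower estimate on
    \<open>S\<close>.\<close>
  have "bounded_linear R"
  proof (rule bounded_linear_intro)
    show "norm (R y) \<le> norm y * (1 / c)" for y
      using lower[of "R y"] \<open>0 < c\<close> by (simp add: R field_simps)
  qed (rule inj, simp add: R blinfun.bilinear_simps)+
  then have "blinfun_apply (Blinfun R) = R"
    by (rule bounded_linear_Blinfun_apply)
  then show ?thesis
    unfolding invertible_op_def
    by (intro exI[of _ "Blinfun R"] conjI blinfun_eqI) (simp_all add: R inj)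
qed

text \<open>Evaluating the form of \<open>P\<close> at \<open>x - P x / K\<close> with \<open>K \<ge> \<parallel>P\<parallel>\<close> bounds \<open>\<parallel>P x\<parallel>\<^sup>2\<close> by
  \<open>K \<langle>P x, x\<rangle>\<close>.\<close>

lemma positive_invertible_coercive:
  assumes P: "positive_op P" and "invertible_op P"
  obtains c where "0 < c" "\<And>x. c * (norm x)\<^sup>2 \<le> rinner (P x) x"
proof -
  obtain R where "R o\<^sub>L P = id_blinfun"
    using assms(2) by (auto simp: invertible_op_def)
  then have R: "R (P x) = x" for x
    by (metis blinfun_apply_blinfun_compose blinfun_apply_id_blinfun)
  define K where "K = norm P + 1"
  define L where "L = norm R + 1"
  have KL: "0 < K" "0 < L" by (auto simp: K_def L_def add_nonneg_pos)
  show ?thesis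
  proof (rule that)
    \<comment> \<open>The constant combines
      \<open>(norm (P x))\<^sup>2 / K \<le> rinner (P x) x\<close> with
      \<open>norm x \<le> L * norm (P x)\<close>, which holds because \<open>R\<close> inverts
      \<open>P\<close>.\<close>
    show "0 < 1 / (K * L\<^sup>2)" using KL by simp
    fix x
    define y where "y = (- (1 / K)) *\<^sub>R P x"
    have sym: "rinner (P y) x = rinner (P x) y"
      using P by (metis positive_op_iff selfadjoint_op_rinner rinner_commute)
    have "rinner (P y) y \<le> K * (norm y)\<^sup>2"
      using rinner_blinfun_le[of P y] by (simp add: K_def distrib_right add_increasing2)
    also have "\<dots> = (norm (P x))\<^sup>2 / K"
      using KL by (simp add: y_def power_divide field_simps power2_eq_square)
    finally have yy: "rinner (P y) y \<le> (norm (P x))\<^sup>2 / K" .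
    have xy: "rinner (P x) y = - ((norm (P x))\<^sup>2 / K)"
      unfolding y_def rinner_scaleR_right rinner_self by simp
    have "0 \<le> rinner (P (x + y)) (x + y)"
      using P by (simp add: positive_op_iff)
    also have "\<dots> = rinner (P x) x + 2 * rinner (P x) y + rinner (P y) y"
      by (simp add: blinfun.bilinear_simps rinner_add_left rinner_add_right sym)
    finally have 1: "(norm (P x))\<^sup>2 / K \<le> rinner (P x) x"
      using yy xy by simp
    have "norm x \<le> L * norm (P x)"
      using norm_blinfun[of R "P x"] by (simp add: R L_def distrib_right add_increasing2)
    then have "(norm x)\<^sup>2 \<le> (L * norm (P x))\<^sup>2"
      by (intro power_mono) auto
    then have "1 / (K * L\<^sup>2) * (norm x)\<^sup>2 \<le> 1 / (K * L\<^sup>2) * (L * norm (P x))\<^sup>2"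
      using KL by (intro mult_left_mono) auto
    also have "\<dots> = (norm (P x))\<^sup>2 / K"
      using KL by (simp add: power_mult_distrib field_simps)
    finally show "1 / (K * L\<^sup>2) * (norm x)\<^sup>2 \<le> rinner (P x) x"
      using 1 by simp
  qed
qed

definition real_spectrum :: "('a::complex_inner \<Rightarrow>\<^sub>L 'a) \<Rightarrow> real set"
  where "real_spectrum T = {t. complex_of_real t \<in> spectrum_op T}"

lemma scalar_op_of_real: "scalar_op (complex_of_real t) = t *\<^sub>R id_blinfun"
  by (rule blinfun_eqI) (simp add: scalar_op.rep_eq scaleC_of_real blinfun.bilinear_simps)

lemma mem_real_spectrum_iff: "t \<in> real_spectrum T \<longleftrightarrow> \<not> invertible_op (T - t *\<^sub>R id_blinfun)"
  by (simp add: real_spectrum_def spectrum_op_def scalar_op_of_real)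

text \<open>For t below c, T - t I is coercive with constant c - t; for t above the norm, t I - T is
  coercive with constant t - norm T.\<close>

lemma real_spectrum_subset:
  fixes T :: "'a::chilbert_space \<Rightarrow>\<^sub>L 'a"
  assumes "\<And>x. c * (norm x)\<^sup>2 \<le> rinner (T x) x"
  shows "real_spectrum T \<subseteq> {c..norm T}"
proof
  fix t assume t: "t \<in> real_spectrum T"
  have "\<not> t < c"
  proof
    assume "t < c"
    have "invertible_op (T - t *\<^sub>R id_blinfun)"
      by (rule invertible_op_coercive[of "c - t"])
        (use \<open>t < c\<close> assms in \<open>auto simp: blinfun.bilinear_simps rinner.diff_left rinner_scaleR_left
           rinner_self algebra_simps\<close>)
    then show False using t mem_real_spectrum_iff by blast
  qed
  moreover have "\<not> norm T < t"
  proof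
    assume "norm T < t"
    have "invertible_op (t *\<^sub>R id_blinfun - T)"
      by (rule invertible_op_coercive[of "t - norm T"])
        (use \<open>norm T < t\<close> rinner_blinfun_le[of T] in \<open>auto simp: blinfun.bilinear_simps rinner.diff_left
           rinner_scaleR_left rinner_self algebra_simps\<close>)
    then have "invertible_op (T - t *\<^sub>R id_blinfun)"
      using invertible_op_scaleR[of "t *\<^sub>R id_blinfun - T" "-1"] by simp
    then show False using t mem_real_spectrum_iff by blast
  qed
  ultimately show "t \<in> {c..norm T}" by auto
qed

subsection \<open>Polynomials in an operator\<close>

lemma poly_op_eq_sum:
  assumes "degree q \<le> n"
  shows "poly_op q T = (\<Sum>i\<le>n. coeff q i *\<^sub>R (((o\<^sub>L) T ^^ i) id_blinfun))"
  unfolding poly_op_def using assms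
  by (intro sum.mono_neutral_left) (auto simp: not_le coeff_eq_0)

text \<open>Horner's rule, the recursion behind the inductions on polynomials below.\<close>

lemma poly_op_pCons: "poly_op (pCons a q) T = a *\<^sub>R id_blinfun + (T o\<^sub>L poly_op q T)"
proof -
  \<comment> \<open>For \<open>q = 0\<close> this upper limit exceeds the degree; the extra
    coefficient is zero.\<close>
  have "poly_op (pCons a q) T =
      (\<Sum>i\<le>Suc (degree q). coeff (pCons a q) i *\<^sub>R (((o\<^sub>L) T ^^ i) id_blinfun))"
    by (rule poly_op_eq_sum) (simp add: degree_pCons_le)
  also have "\<dots> = a *\<^sub>R id_blinfun + (T o\<^sub>L poly_op q T)"
    by (simp add: sum.atMost_Suc_shift poly_op_def blinfun_compose.sum_right blinfun_compose.scaleR_right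
        del: sum.atMost_Suc)
  finally show ?thesis .
qed

lemma poly_op_0: "poly_op 0 T = 0"
  by (simp add: poly_op_def)

lemma poly_op_const: "poly_op [:a:] T = a *\<^sub>R id_blinfun"
  by (simp add: poly_op_pCons poly_op_0)

lemma poly_op_X: "poly_op [:0, 1:] T = T"
  by (simp add: poly_op_pCons poly_op_0)

lemma poly_op_add: "poly_op (q + r) T = poly_op q T + poly_op r T"
  by (induction q r rule: poly_induct2)
    (simp_all add: poly_op_0 poly_op_pCons blinfun_compose.add_right scaleR_left_distrib)

lemma poly_op_smult: "poly_op (Polynomial.smult a q) T = a *\<^sub>R poly_op q T"
  by (induction q)
    (simp_all add: poly_op_0 poly_op_pCons blinfun_compose.scaleR_right scaleR_right_distrib)

lemma poly_op_diff: "poly_op (q - r) T = poly_op q T - poly_op r T"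
  using poly_op_add[of q "Polynomial.smult (-1) r" T] unfolding poly_op_smult by simp

lemma poly_op_mult: "poly_op (q * r) T = poly_op q T o\<^sub>L poly_op r T"
proof (induction q)
  case (pCons a q)
  then show ?case
    by (simp add: poly_op_add poly_op_smult poly_op_pCons blinfun_compose.add_left
        blinfun_compose.scaleR_left) (auto intro: blinfun_eqI)
qed (simp add: poly_op_0)

lemma poly_op_pcompose: "poly_op (pcompose q r) T = poly_op q (poly_op r T)"
  by (induction q) (simp_all add: poly_op_0 poly_op_pCons pcompose_pCons poly_op_add poly_op_mult poly_op_const)

lemma poly_op_commute: "poly_op q T o\<^sub>L poly_op r T = poly_op r T o\<^sub>L poly_op q T"
  by (metis poly_op_mult mult.commute)

lemma selfadjoint_poly_op:
  assumes "selfadjoint_op T"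
  shows "selfadjoint_op (poly_op q T)"
proof (induction q)
  case 0
  then show ?case by (simp add: poly_op_0 selfadjoint_op_zero)
next
  case (pCons a q)
  have "T o\<^sub>L poly_op q T = poly_op q T o\<^sub>L T"
    using poly_op_commute[of "[:0, 1:]" T q] by (simp add: poly_op_X)
  then show ?case
    unfolding poly_op_pCons
    by (intro selfadjoint_op_add selfadjoint_op_scaleR selfadjoint_op_id
        selfadjoint_op_compose_commute assms pCons)
qed

text \<open>With the next two lemmas, this allows a division with remainder of real polynomials to
  be evaluated at a complex root.\<close>

lemma poly_map_poly_of_real_add:
  "poly (map_poly complex_of_real (q + r)) z =
    poly (map_poly complex_of_real q) z + poly (map_poly complex_of_real r) z"
  by (induction q r rule: poly_induct2) (simp_all add: map_poly_pCons algebra_simps)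

lemma poly_map_poly_of_real_smult:
  "poly (map_poly complex_of_real (Polynomial.smult c q)) z =
    of_real c * poly (map_poly complex_of_real q) z"
  by (induction q) (simp_all add: map_poly_pCons algebra_simps)

lemma poly_map_poly_of_real_mult:
  "poly (map_poly complex_of_real (q * r)) z =
    poly (map_poly complex_of_real q) z * poly (map_poly complex_of_real r) z"
  by (induction q)
    (simp_all add: map_poly_pCons poly_map_poly_of_real_add poly_map_poly_of_real_smult algebra_simps)

text \<open>The factor is linear or of the form \<open>(x - a)\<^sup>2 + b\<^sup>2\<close> according to whether a complex root
  is real.\<close>

lemma real_poly_factor:
  fixes q :: "real poly"
  assumes "0 < degree q"
  obtains t r where "q = [:- t, 1:] * r"
  | a b r where "b \<noteq> 0" "q = [:a\<^sup>2 + b\<^sup>2, - 2 * a, 1:] * r"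
proof -
  let ?e = "\<lambda>q. poly (map_poly complex_of_real q)"
  have "degree (map_poly complex_of_real q) = degree q"
    by (rule degree_map_poly) simp
  then have "\<not> constant (poly (map_poly complex_of_real q))"
    using assms by (simp add: constant_degree)
  then obtain z where z: "?e q z = 0"
    using fundamental_theorem_of_algebra by blast
  show thesis
  proof (cases "Im z = 0")
    case True
    then have "z = of_real (Re z)" by (simp add: complex_eq_iff)
    moreover have "?e q (of_real x) = of_real (poly q x)" for x
      by (induction q) (simp_all add: map_poly_pCons)
    ultimately have "poly q (Re z) = 0"
      using z by (metis of_real_eq_0_iff)
    then show thesis
      using that(1) by (metis poly_eq_0_iff_dvd dvd_def)
  next
    case False
    \<comment> \<open>The monic real quadratic whose roots are \<open>z\<close> and its
      conjugate.\<close>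
    define d where "d = [:(Re z)\<^sup>2 + (Im z)\<^sup>2, - 2 * Re z, 1:]"
    define m where "m = q mod d"
    have "?e d z = 0"
      by (simp add: d_def map_poly_pCons complex_eq_iff power2_eq_square algebra_simps)
    moreover have "q = d * (q div d) + m" by (simp add: m_def)
    then have "?e q z = ?e d z * ?e (q div d) z + ?e m z"
      by (metis poly_map_poly_of_real_add poly_map_poly_of_real_mult)
    ultimately have "?e m z = 0" using z by simp
    have "degree m < 2"
      using degree_mod_less'[of d q] by (cases "m = 0") (auto simp: m_def d_def)
    then obtain u v where m: "m = [:u, v:]"
    proof -
      have "coeff m i = coeff [:coeff m 0, coeff m 1:] i" for i
        using \<open>degree m < 2\<close> by (auto simp: coeff_pCons coeff_eq_0 split: nat.split)
      then show thesis using that poly_eqI by blast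
    qed
    \<comment> \<open>A real remainder of degree at most one that vanishes at a non-real point is
      zero: compare imaginary, then real parts.\<close>
    have "?e [:u, v:] z = of_real u + z * of_real v"
      by (simp add: map_poly_pCons)
    then have "of_real u + z * of_real v = 0"
      using \<open>?e m z = 0\<close> unfolding m by simp
    then have "u + Re z * v = 0" "Im z * v = 0"
      by (simp_all add: complex_eq_iff)
    then have "u = 0" "v = 0" using False by auto
    then have "m = 0" by (simp add: m)
    then show thesis
      using that(2)[OF False, of "Re z" "q div d"] \<open>q = d * (q div d) + m\<close> unfolding d_def by simp
  qed
qed

text \<open>Split off one real factor that is invertible at \<open>T\<close>; the cofactor still has
  no root in the spectrum. The induction is strong because a quadratic factor lowers the degree by
  two.\<close>

lemma invertible_poly_op:
  fixes T :: "'a::chilbert_space \<Rightarrow>\<^sub>L 'a"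
  assumes T: "selfadjoint_op T"
  shows "q \<noteq> 0 \<Longrightarrow> (\<And>t. t \<in> real_spectrum T \<Longrightarrow> poly q t \<noteq> 0) \<Longrightarrow> invertible_op (poly_op q T)"
proof (induction "degree q" arbitrary: q rule: less_induct)
  case less
  show ?case
  proof (cases "degree q = 0")
    case True
    then obtain a where "q = [:a:]" by (metis degree_eq_zeroE)
    then show ?thesis
      using less.prems(1) by (simp add: poly_op_const invertible_op_scaleR invertible_op_id)
  next
    case False
    then have "0 < degree q" by simp
    then consider t r where "q = [:- t, 1:] * r"
      | a b r where "b \<noteq> 0" "q = [:a\<^sup>2 + b\<^sup>2, - 2 * a, 1:] * r"
      using real_poly_factor by metis
    then obtain d r where qdr: "q = d * r" and "0 < degree d" and inv: "invertible_op (poly_op d T)"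
    proof cases
      case 1
      have "poly_op [:- t, 1:] T = T - t *\<^sub>R id_blinfun"
        by (simp add: poly_op_pCons poly_op_0)
      moreover have "t \<notin> real_spectrum T"
        using less.prems(2)[of t] by (auto simp: 1)
      ultimately have "invertible_op (poly_op [:- t, 1:] T)"
        using mem_real_spectrum_iff by metis
      then show thesis by (intro that[OF 1]) auto
    next
      case 2
      let ?d = "[:a\<^sup>2 + b\<^sup>2, - 2 * a, 1:]"
      \<comment> \<open>Self-adjointness turns the form of (T - a I)^2 + b^2 I into a sum of
        squares, so it is coercive with constant \<open>b\<^sup>2\<close>.\<close>
      have *: "rinner (poly_op ?d T x) x = (norm (T x - a *\<^sub>R x))\<^sup>2 + b\<^sup>2 * (norm x)\<^sup>2" for x
      proof -
        have "rinner (T (T x)) x = rinner (T x) (T x)" "rinner x (T x) = rinner (T x) x"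
          using T by (auto simp: selfadjoint_op_rinner rinner_commute)
        then show ?thesis
          unfolding rinner_self[symmetric]
          by (simp add: poly_op_pCons poly_op_0 blinfun.bilinear_simps rinner.diff_left rinner.diff_right
              rinner_add_left rinner_scaleR_left rinner_scaleR_right algebra_simps power2_eq_square)
      qed
      have "invertible_op (poly_op ?d T)"
        by (rule invertible_op_coercive[of "b\<^sup>2"]) (use \<open>b \<noteq> 0\<close> * in auto)
      then show thesis by (intro that[OF 2(2)]) auto
    qed
    have "d \<noteq> 0" "r \<noteq> 0" using less.prems(1) qdr by auto
    then have "degree r < degree q"
      using \<open>0 < degree d\<close> by (simp add: qdr degree_mult_eq)
    then have "invertible_op (poly_op r T)"
      using less.prems(2) \<open>r \<noteq> 0\<close> by (intro less.hyps) (auto simp: qdr)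
    then show ?thesis
      by (simp add: qdr poly_op_mult invertible_op_compose inv)
  qed
qed

text \<open>The least \<open>s \<ge> 0\<close> with \<open>q(T) + s I \<ge> 0\<close> is \<open>0\<close>: otherwise \<open>q + s\<close> has no root in the
  spectrum, so \<open>q(T) + s I\<close> is invertible and positive, hence coercive, and \<open>s\<close> can be decreased.
  Constant \<open>q\<close> are excluded because the spectrum is empty on the zero space.\<close>

lemma positive_poly_op_nonconstant:
  fixes T :: "'a::chilbert_space \<Rightarrow>\<^sub>L 'a"
  assumes T: "selfadjoint_op T" and "0 < degree q"
    and nonneg: "\<And>t. t \<in> real_spectrum T \<Longrightarrow> 0 \<le> poly q t"
  shows "positive_op (poly_op q T)"
proof -
  let ?S = "poly_op q T"
  define N where "N = {s. 0 \<le> s \<and> (\<forall>x. 0 \<le> rinner (?S x) x + s * (norm x)\<^sup>2)}"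
  have "norm ?S \<in> N"
  proof -
    have "0 \<le> rinner (?S x) x + norm ?S * (norm x)\<^sup>2" for x
      using rinner_blinfun_le[of "- ?S" x] by (simp add: blinfun.bilinear_simps rinner.minus_left)
    then show ?thesis by (simp add: N_def)
  qed
  have bdd: "bdd_below N" by (rule bdd_belowI[of _ 0]) (simp add: N_def)
  \<comment> \<open>\<open>N\<close> is cut out by closed conditions on \<open>s\<close>, so its
    infimum is attained.\<close>
  have "N = {0..} \<inter> (\<Inter>x. {s. 0 \<le> rinner (?S x) x + s * (norm x)\<^sup>2})"
    by (auto simp: N_def)
  then have "closed N"
    by (auto intro!: closed_INT closed_Collect_le continuous_intros)
  define s where "s = Inf N"
  have "s \<in> N"
    unfolding s_def using \<open>norm ?S \<in> N\<close> bdd \<open>closed N\<close> by (intro closed_contains_Inf) auto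
  have "s = 0"
  proof (rule ccontr)
    assume "s \<noteq> 0"
    then have "0 < s" using \<open>s \<in> N\<close> by (simp add: N_def)
    let ?P = "poly_op (q + [:s:]) T"
    have P: "rinner (?P x) x = rinner (?S x) x + s * (norm x)\<^sup>2" for x
      by (simp add: poly_op_add poly_op_const blinfun.bilinear_simps rinner_add_left
          rinner_scaleR_left rinner_self)
    \<comment> \<open>Here the positive degree matters: a constant \<open>q\<close> equal to
      \<open>- s\<close> would cancel.\<close>
    have "q + [:s:] \<noteq> 0"
      using \<open>0 < degree q\<close> degree_add_eq_left[of "[:s:]" q] by (metis degree_0 degree_pCons_0 less_irrefl)
    moreover have "poly (q + [:s:]) t \<noteq> 0" if "t \<in> real_spectrum T" for t
      using nonneg[OF that] \<open>0 < s\<close> by simp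
    ultimately have "invertible_op ?P"
      by (rule invertible_poly_op[OF T])
    moreover have "positive_op ?P"
      using \<open>s \<in> N\<close> P by (simp add: positive_op_iff selfadjoint_poly_op T N_def)
    ultimately obtain c where c: "0 < c" "\<And>x. c * (norm x)\<^sup>2 \<le> rinner (?P x) x"
      using positive_invertible_coercive by metis
    \<comment> \<open>Capping by \<open>s\<close> keeps \<open>s - c'\<close> nonnegative, as
      membership in \<open>N\<close> demands.\<close>
    define c' where "c' = min c s"
    have "0 < c'" "c' \<le> s" using c \<open>0 < s\<close> by (auto simp: c'_def)
    have "c' * (norm x)\<^sup>2 \<le> rinner (?P x) x" for x
      by (rule order_trans[OF _ c(2)]) (simp add: c'_def mult_right_mono)
    then have "s - c' \<in> N"
      using \<open>c' \<le> s\<close> by (simp add: N_def P algebra_simps)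
    then have "s \<le> s - c'"
      unfolding s_def using bdd by (rule cInf_lower)
    then show False using \<open>0 < c'\<close> by simp
  qed
  then show ?thesis
    using \<open>s \<in> N\<close> by (simp add: positive_op_iff selfadjoint_poly_op T N_def)
qed

lemma positive_poly_op:
  fixes T :: "'a::chilbert_space \<Rightarrow>\<^sub>L 'a"
  assumes T: "selfadjoint_op T" and nonneg: "\<And>t. t \<in> real_spectrum T \<Longrightarrow> 0 \<le> poly q t"
  shows "positive_op (poly_op q T)"
proof (cases "degree q = 0")
  case False
  then show ?thesis using positive_poly_op_nonconstant[OF T _ nonneg] by simp
next
  case True
  then obtain a where q: "q = [:a:]" by (metis degree_eq_zeroE)
  have "0 \<le> a * (norm x)\<^sup>2" for x :: 'a
  proof (cases "0 \<le> a")
    case False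
    \<comment> \<open>A negative constant is nonnegative on the spectrum only if the spectrum is
      empty. Then T - (norm T + 1) I is positive as well, while its form is at most minus the
      squared norm, so every vector is zero.\<close>
    then have empty: "t \<notin> real_spectrum T" for t using nonneg[of t] q by auto
    have "positive_op (poly_op [:- (norm T + 1), 1:] T)"
      by (rule positive_poly_op_nonconstant[OF T]) (use empty in auto)
    then have "0 \<le> rinner (T x) x - (norm T + 1) * (norm x)\<^sup>2"
      by (simp add: positive_op_iff poly_op_pCons poly_op_0 blinfun.bilinear_simps rinner_add_left
          rinner.diff_left rinner_scaleR_left rinner_self algebra_simps)
    then have "(norm x)\<^sup>2 \<le> 0"
      using rinner_blinfun_le[of T x] unfolding distrib_right by linarith
    then show ?thesis by simp
  qed simp
  then show ?thesis
    by (simp add: q poly_op_const positive_op_iff selfadjoint_op_scaleR selfadjoint_op_id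
        blinfun.bilinear_simps rinner_scaleR_left rinner_self)
qed

text \<open>The polynomial e^2 - q^2 is nonnegative on the spectrum, and by self-adjointness its
  form at \<open>T\<close> is e^2 |x|^2 - |q(T) x|^2.\<close>

lemma norm_poly_op_le:
  fixes T :: "'a::chilbert_space \<Rightarrow>\<^sub>L 'a"
  assumes T: "selfadjoint_op T" and "0 \<le> e"
    and bound: "\<And>t. t \<in> real_spectrum T \<Longrightarrow> \<bar>poly q t\<bar> \<le> e"
  shows "norm (poly_op q T) \<le> e"
proof (rule norm_blinfun_bound[OF \<open>0 \<le> e\<close>])
  fix x
  have "positive_op (poly_op ([:e\<^sup>2:] - q * q) T)"
  proof (rule positive_poly_op[OF T])
    fix t assume "t \<in> real_spectrum T"
    then have "(poly q t)\<^sup>2 \<le> e\<^sup>2"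
      using bound \<open>0 \<le> e\<close> by (metis abs_ge_zero power2_abs power_mono)
    then show "0 \<le> poly ([:e\<^sup>2:] - q * q) t"
      by (simp add: power2_eq_square)
  qed
  then have "0 \<le> rinner (poly_op ([:e\<^sup>2:] - q * q) T x) x"
    unfolding positive_op_iff by blast
  also have "\<dots> = (e * norm x)\<^sup>2 - (norm (poly_op q T x))\<^sup>2"
    unfolding poly_op_diff poly_op_mult poly_op_const
    by (simp add: blinfun.bilinear_simps rinner.diff_left rinner_scaleR_left rinner_self
        selfadjoint_op_rinner[OF selfadjoint_poly_op[OF T]] power_mult_distrib)
  finally show "norm (poly_op q T x) \<le> e * norm x"
    using \<open>0 \<le> e\<close> by (intro power2_le_imp_le[of "norm (poly_op q T x)"]) auto
qed

subsection \<open>Continuous functional calculus\<close>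

text \<open>The predicate under the definite description in \<open>fun_calc\<close>. As a relation
  it can be combined through approximating sequences before existence or uniqueness of f(T) is
  known.\<close>

definition calculus_limit :: "(real \<Rightarrow> real) \<Rightarrow> ('a::complex_inner \<Rightarrow>\<^sub>L 'a) \<Rightarrow> ('a \<Rightarrow>\<^sub>L 'a) \<Rightarrow> bool"
  where "calculus_limit f T S \<longleftrightarrow> (\<exists>q :: nat \<Rightarrow> real poly.
    uniform_limit (real_spectrum T) (\<lambda>n. poly (q n)) f sequentially \<and>
    (\<lambda>n. poly_op (q n) T) \<longlonglongrightarrow> S)"

lemma calculus_limit_cong:
  assumes "calculus_limit f T S" "\<And>t. t \<in> real_spectrum T \<Longrightarrow> f t = g t"
  shows "calculus_limit g T S"
proof -
  have "uniform_limit (real_spectrum T) q f F \<longleftrightarrow> uniform_limit (real_spectrum T) q g F"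
    for q :: "nat \<Rightarrow> real \<Rightarrow> real" and F
    by (rule uniform_limit_cong') (use assms(2) in auto)
  then show ?thesis using assms(1) unfolding calculus_limit_def by simp
qed

lemma calculus_limit_poly: "calculus_limit (poly q) T (poly_op q T)"
  unfolding calculus_limit_def
  by (intro exI[of _ "\<lambda>_. q"] conjI tendsto_const) (simp add: uniform_limit_iff)

lemma calculus_limit_add:
  assumes "calculus_limit f T S" "calculus_limit g T R"
  shows "calculus_limit (\<lambda>t. f t + g t) T (S + R)"
proof -
  obtain q r where "uniform_limit (real_spectrum T) (\<lambda>n. poly (q n)) f sequentially"
      "uniform_limit (real_spectrum T) (\<lambda>n. poly (r n)) g sequentially"
      "(\<lambda>n. poly_op (q n) T) \<longlonglongrightarrow> S" "(\<lambda>n. poly_op (r n) T) \<longlonglongrightarrow> R"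
    using assms unfolding calculus_limit_def by metis
  then show ?thesis
    unfolding calculus_limit_def
    by (intro exI[of _ "\<lambda>n. q n + r n"])
      (auto simp: poly_op_add poly_add[abs_def] intro: tendsto_add uniform_limit_add)
qed

text \<open>Some polynomial stays within 1 of \<open>f\<close> on the spectrum and is bounded on a
  compact interval containing it. Products of uniform limits rely on this bound.\<close>

lemma calculus_limit_bounded:
  fixes T :: "'a::chilbert_space \<Rightarrow>\<^sub>L 'a"
  assumes "calculus_limit f T S"
  shows "bounded (f ` real_spectrum T)"
proof -
  have "real_spectrum T \<subseteq> {- norm T..norm T}"
    by (rule real_spectrum_subset)
      (use rinner_blinfun_le[of "- T"] in \<open>simp add: blinfun.bilinear_simps rinner.minus_left minus_le_iff\<close>)
  then have *: "bounded (poly q ` real_spectrum T)" for q :: "real poly"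
    by (intro bounded_subset[OF compact_imp_bounded[OF compact_continuous_image[of "{- norm T..norm T}" "poly q"]]])
      (auto intro!: continuous_intros)
  obtain q where "uniform_limit (real_spectrum T) (\<lambda>n. poly (q n)) f sequentially"
    using assms unfolding calculus_limit_def by metis
  then have "\<forall>\<^sub>F n in sequentially. \<forall>t\<in>real_spectrum T. dist (poly (q n) t) (f t) < 1"
    by (rule uniform_limitD) simp
  then obtain n where n: "\<And>t. t \<in> real_spectrum T \<Longrightarrow> \<bar>poly (q n) t - f t\<bar> < 1"
    unfolding eventually_sequentially dist_real_def by blast
  obtain b where b: "\<And>t. t \<in> real_spectrum T \<Longrightarrow> \<bar>poly (q n) t\<bar> \<le> b"
    using *[of "q n"] unfolding bounded_iff by auto
  have "\<bar>f t\<bar> \<le> b + 1" if "t \<in> real_spectrum T" for t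
    using n[OF that] b[OF that] by linarith
  then show ?thesis
    unfolding bounded_iff by (intro exI[of _ "b + 1"]) auto
qed

lemma calculus_limit_mult:
  fixes T :: "'a::chilbert_space \<Rightarrow>\<^sub>L 'a"
  assumes "calculus_limit f T S" "calculus_limit g T R"
  shows "calculus_limit (\<lambda>t. f t * g t) T (S o\<^sub>L R)"
proof -
  note bdd = assms[THEN calculus_limit_bounded]
  obtain q r where "uniform_limit (real_spectrum T) (\<lambda>n. poly (q n)) f sequentially"
      "uniform_limit (real_spectrum T) (\<lambda>n. poly (r n)) g sequentially"
      "(\<lambda>n. poly_op (q n) T) \<longlonglongrightarrow> S" "(\<lambda>n. poly_op (r n) T) \<longlonglongrightarrow> R"
    using assms unfolding calculus_limit_def by metis
  then show ?thesis
    unfolding calculus_limit_def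
    by (intro exI[of _ "\<lambda>n. q n * r n"])
      (auto simp: poly_op_mult poly_mult[abs_def] intro: blinfun_compose.tendsto uniform_lim_mult[OF _ _ bdd])
qed

lemma calculus_limit_const: "calculus_limit (\<lambda>_. c) T (c *\<^sub>R id_blinfun)"
  using calculus_limit_poly[of "[:c:]" T] by (simp add: poly_op_const poly_pCons[abs_def])

lemma calculus_limit_id: "calculus_limit (\<lambda>t. t) T T"
  using calculus_limit_poly[of "[:0, 1:]" T] by (simp add: poly_op_X poly_pCons[abs_def])

lemma calculus_limit_scaleR:
  fixes T :: "'a::chilbert_space \<Rightarrow>\<^sub>L 'a"
  assumes "calculus_limit f T S"
  shows "calculus_limit (\<lambda>t. c * f t) T (c *\<^sub>R S)"
  using calculus_limit_mult[OF calculus_limit_const assms, of c]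
  by (simp add: blinfun_compose.scaleR_left)

lemma calculus_limit_diff:
  fixes T :: "'a::chilbert_space \<Rightarrow>\<^sub>L 'a"
  assumes "calculus_limit f T S" "calculus_limit g T R"
  shows "calculus_limit (\<lambda>t. f t - g t) T (S - R)"
  using calculus_limit_add[OF assms(1) calculus_limit_scaleR[OF assms(2), of "-1"]] by simp

lemma calculus_limit_selfadjoint:
  assumes "selfadjoint_op T" "calculus_limit f T S"
  shows "selfadjoint_op S"
proof -
  obtain q where "(\<lambda>n. poly_op (q n) T) \<longlonglongrightarrow> S"
    using assms(2) unfolding calculus_limit_def by metis
  then show ?thesis
    by (rule selfadjoint_op_tendsto[rotated]) (rule selfadjoint_poly_op[OF assms(1)])
qed

text \<open>The approximants may dip below zero, but eventually by less than any given e; so q_n(T)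
  + e I is positive, and the bound passes to the limit before e tends to 0.\<close>

lemma calculus_limit_positive:
  fixes T :: "'a::chilbert_space \<Rightarrow>\<^sub>L 'a"
  assumes T: "selfadjoint_op T" and lim: "calculus_limit f T S"
    and nonneg: "\<And>t. t \<in> real_spectrum T \<Longrightarrow> 0 \<le> f t"
  shows "positive_op S"
  unfolding positive_op_iff
proof (intro conjI allI calculus_limit_selfadjoint[OF T lim])
  fix x
  obtain q where q: "uniform_limit (real_spectrum T) (\<lambda>n. poly (q n)) f sequentially"
    "(\<lambda>n. poly_op (q n) T) \<longlonglongrightarrow> S"
    using lim unfolding calculus_limit_def by metis
  have lb: "- (e * (norm x)\<^sup>2) \<le> rinner (S x) x" if "0 < e" for e
  proof (rule tendsto_lowerbound)
    show "(\<lambda>n. rinner (poly_op (q n) T x) x) \<longlonglongrightarrow> rinner (S x) x"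
      by (intro rinner.tendsto tendsto_blinfun_apply q tendsto_const)
    have "\<forall>\<^sub>F n in sequentially. \<forall>t\<in>real_spectrum T. dist (poly (q n) t) (f t) < e"
      using q(1) that by (rule uniform_limitD)
    then show "\<forall>\<^sub>F n in sequentially. - (e * (norm x)\<^sup>2) \<le> rinner (poly_op (q n) T x) x"
    proof (rule eventually_mono)
      fix n assume n: "\<forall>t\<in>real_spectrum T. dist (poly (q n) t) (f t) < e"
      have "positive_op (poly_op (q n + [:e:]) T)"
      proof (rule positive_poly_op[OF T])
        fix t assume t: "t \<in> real_spectrum T"
        have "\<bar>poly (q n) t - f t\<bar> < e" using n t unfolding dist_real_def by blast
        then show "0 \<le> poly (q n + [:e:]) t" using nonneg[OF t] by simp
      qed
      then have "0 \<le> rinner (poly_op (q n + [:e:]) T x) x"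
        unfolding positive_op_iff by blast
      then show "- (e * (norm x)\<^sup>2) \<le> rinner (poly_op (q n) T x) x"
        by (simp add: poly_op_add poly_op_const blinfun.bilinear_simps rinner_add_left
            rinner_scaleR_left rinner_self)
    qed
  qed simp
  show "0 \<le> rinner (S x) x"
  proof (rule field_le_epsilon)
    fix e :: real assume "0 < e"
    \<comment> \<open>The tolerance is divided by this quantity, which absorbs the squared norm and
      is nonzero even at \<open>x = 0\<close>.\<close>
    have "0 < (norm x)\<^sup>2 + 1" by (simp add: add_nonneg_pos)
    then have "e / ((norm x)\<^sup>2 + 1) * (norm x)\<^sup>2 \<le> e"
      using \<open>0 < e\<close> by (simp add: field_simps)
    then show "0 \<le> rinner (S x) x + e"
      using lb[of "e / ((norm x)\<^sup>2 + 1)"] \<open>0 < e\<close> \<open>0 < (norm x)\<^sup>2 + 1\<close> by simp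
  qed
qed

text \<open>One estimate with two uses: distinct sequences with \<open>m = n\<close> give uniqueness
  of the limit, equal sequences give the Cauchy property.\<close>

lemma eventually_norm_poly_op_diff:
  fixes T :: "'a::chilbert_space \<Rightarrow>\<^sub>L 'a"
  assumes T: "selfadjoint_op T" and "0 < e"
    and q: "uniform_limit (real_spectrum T) (\<lambda>n. poly (q n)) f sequentially"
    and r: "uniform_limit (real_spectrum T) (\<lambda>n. poly (r n)) f sequentially"
  obtains N where "\<And>m n. m \<ge> N \<Longrightarrow> n \<ge> N \<Longrightarrow> norm (poly_op (q m) T - poly_op (r n) T) \<le> e"
proof -
  obtain N1 N2 where
    N1: "\<And>n t. n \<ge> N1 \<Longrightarrow> t \<in> real_spectrum T \<Longrightarrow> dist (poly (q n) t) (f t) < e / 2" and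
    N2: "\<And>n t. n \<ge> N2 \<Longrightarrow> t \<in> real_spectrum T \<Longrightarrow> dist (poly (r n) t) (f t) < e / 2"
    using uniform_limitD[OF q, of "e / 2"] uniform_limitD[OF r, of "e / 2"] \<open>0 < e\<close>
    unfolding eventually_sequentially by (metis half_gt_zero)
  show thesis
  proof (rule that)
    fix m n assume mn: "m \<ge> max N1 N2" "n \<ge> max N1 N2"
    have "norm (poly_op (q m - r n) T) \<le> e"
    proof (rule norm_poly_op_le[OF T])
      fix t assume "t \<in> real_spectrum T"
      then have "\<bar>poly (q m) t - f t\<bar> < e / 2" "\<bar>poly (r n) t - f t\<bar> < e / 2"
        using N1[of m t] N2[of n t] mn unfolding dist_real_def by auto
      then show "\<bar>poly (q m - r n) t\<bar> \<le> e" by (simp add: abs_if split: if_splits)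
    qed (use \<open>0 < e\<close> in simp)
    then show "norm (poly_op (q m) T - poly_op (r n) T) \<le> e"
      by (simp only: poly_op_diff)
  qed
qed

lemma calculus_limit_unique:
  fixes T :: "'a::chilbert_space \<Rightarrow>\<^sub>L 'a"
  assumes T: "selfadjoint_op T" and "calculus_limit f T S" "calculus_limit f T R"
  shows "S = R"
proof -
  obtain q r where qr: "uniform_limit (real_spectrum T) (\<lambda>n. poly (q n)) f sequentially"
      "uniform_limit (real_spectrum T) (\<lambda>n. poly (r n)) f sequentially"
      "(\<lambda>n. poly_op (q n) T) \<longlonglongrightarrow> S" "(\<lambda>n. poly_op (r n) T) \<longlonglongrightarrow> R"
    using assms unfolding calculus_limit_def by metis
  have lim: "(\<lambda>n. norm (poly_op (q n) T - poly_op (r n) T)) \<longlonglongrightarrow> norm (S - R)"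
    by (intro tendsto_norm tendsto_diff qr)
  have "norm (S - R) \<le> e" if "0 < e" for e
  proof -
    obtain N where "\<And>m n. m \<ge> N \<Longrightarrow> n \<ge> N \<Longrightarrow> norm (poly_op (q m) T - poly_op (r n) T) \<le> e"
      using eventually_norm_poly_op_diff[OF T \<open>0 < e\<close> qr(1,2)] by blast
    then show ?thesis
      by (intro LIMSEQ_le_const2[OF lim]) blast
  qed
  then have "norm (S - R) \<le> 0"
    by (rule field_le_epsilon) (simp add: \<open>\<And>e. 0 < e \<Longrightarrow> norm (S - R) \<le> e\<close>)
  then show ?thesis by simp
qed

lemma fun_calc_eq:
  fixes T :: "'a::chilbert_space \<Rightarrow>\<^sub>L 'a"
  assumes "selfadjoint_op T" "calculus_limit f T S"
  shows "fun_calc f T = S"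
  unfolding fun_calc_def calculus_limit_def[unfolded real_spectrum_def, symmetric]
  using assms calculus_limit_unique by blast

lemma convergent_poly_op:
  fixes T :: "'a::chilbert_space \<Rightarrow>\<^sub>L 'a"
  assumes T: "selfadjoint_op T"
    and q: "uniform_limit (real_spectrum T) (\<lambda>n. poly (q n)) f sequentially"
  shows "convergent (\<lambda>n. poly_op (q n) T)"
proof (rule Cauchy_convergent, rule CauchyI)
  fix e :: real assume "0 < e"
  then have "0 < e / 2" by simp
  then obtain N where N: "\<And>m n. m \<ge> N \<Longrightarrow> n \<ge> N \<Longrightarrow> norm (poly_op (q m) T - poly_op (q n) T) \<le> e / 2"
    using eventually_norm_poly_op_diff[OF T _ q q] by blast
  have "norm (poly_op (q m) T - poly_op (q n) T) < e" if "m \<ge> N" "n \<ge> N" for m n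
    using N[OF that] \<open>0 < e\<close> by linarith
  then show "\<exists>M. \<forall>m\<ge>M. \<forall>n\<ge>M. norm (poly_op (q m) T - poly_op (q n) T) < e"
    by blast
qed

lemma fun_calc_limit:
  fixes T :: "'a::chilbert_space \<Rightarrow>\<^sub>L 'a"
  assumes T: "selfadjoint_op T"
    and q: "uniform_limit (real_spectrum T) (\<lambda>n. poly (q n)) f sequentially"
  shows "(\<lambda>n. poly_op (q n) T) \<longlonglongrightarrow> fun_calc f T"
proof -
  obtain S where S: "(\<lambda>n. poly_op (q n) T) \<longlonglongrightarrow> S"
    using convergent_poly_op[OF T q] unfolding convergent_def by blast
  then have "calculus_limit f T S"
    using q unfolding calculus_limit_def by blast
  then show ?thesis using S fun_calc_eq[OF T] by simp
qed

lemma Weierstrass_poly: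
  fixes f :: "real \<Rightarrow> real"
  assumes "continuous_on {a..b} f"
  obtains q :: "nat \<Rightarrow> real poly" where "uniform_limit {a..b} (\<lambda>n. poly (q n)) f sequentially"
proof -
  have "\<exists>q :: real poly. \<forall>t\<in>{a..b}. \<bar>f t - poly q t\<bar> < inverse (real (Suc n))" for n
  proof -
    obtain g where g: "real_polynomial_function g" "\<And>t. t \<in> {a..b} \<Longrightarrow> \<bar>f t - g t\<bar> < inverse (real (Suc n))"
      using Stone_Weierstrass_real_polynomial_function[OF compact_Icc assms, of "inverse (real (Suc n))"]
      by (auto simp del: of_nat_Suc)
    obtain c m where "g = (\<lambda>t. \<Sum>i\<le>m. c i * t ^ i)"
      using g(1) by (auto simp: real_polynomial_function_iff_sum)
    then have "g = poly (\<Sum>i\<le>m. monom (c i) i)"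
      by (auto simp: poly_sum poly_monom)
    then show ?thesis using g(2) by blast
  qed
  then obtain q :: "nat \<Rightarrow> real poly"
    where q: "\<And>n t. t \<in> {a..b} \<Longrightarrow> \<bar>f t - poly (q n) t\<bar> < inverse (real (Suc n))"
    by metis
  have "uniform_limit {a..b} (\<lambda>n. poly (q n)) f sequentially"
  proof (rule uniform_limitI)
    fix e :: real assume "0 < e"
    then obtain N where N: "inverse (real (Suc N)) < e"
      using reals_Archimedean by blast
    have "dist (poly (q n) t) (f t) < e" if "n \<ge> N" "t \<in> {a..b}" for n t
    proof -
      have "inverse (real (Suc n)) \<le> inverse (real (Suc N))"
        using that(1) by (intro le_imp_inverse_le) auto
      then show ?thesis
        using q[OF that(2), of n] N unfolding dist_real_def by linarith
    qed
    then show "\<forall>\<^sub>F n in sequentially. \<forall>t\<in>{a..b}. dist (poly (q n) t) (f t) < e"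
      unfolding eventually_sequentially by blast
  qed
  then show thesis by (rule that)
qed

text \<open>With \<open>l\<close> the identity this gives the existence of \<open>f(T)\<close>. Approximating on an interval
  rather than on the spectrum avoids a spectral mapping theorem for \<open>l\<close>.\<close>

lemma calculus_limit_poly_compose:
  fixes T :: "'a::chilbert_space \<Rightarrow>\<^sub>L 'a"
  assumes T: "selfadjoint_op T" and cont: "continuous_on {a..b} f"
    and spectrum: "real_spectrum (poly_op l T) \<subseteq> {a..b}"
    and maps: "\<And>t. t \<in> real_spectrum T \<Longrightarrow> poly l t \<in> {a..b}"
  shows "calculus_limit (\<lambda>t. f (poly l t)) T (fun_calc f (poly_op l T))"
proof -
  obtain q where q: "uniform_limit {a..b} (\<lambda>n. poly (q n)) f sequentially"
    using Weierstrass_poly[OF cont] by blast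
  have "(\<lambda>n. poly_op (q n) (poly_op l T)) \<longlonglongrightarrow> fun_calc f (poly_op l T)"
    by (intro fun_calc_limit selfadjoint_poly_op T uniform_limit_on_subset[OF q spectrum])
  moreover have "uniform_limit (real_spectrum T) (\<lambda>n t. poly (q n) (poly l t)) (\<lambda>t. f (poly l t)) sequentially"
    by (rule uniform_limit_compose'[OF q]) (use maps in blast)
  ultimately show ?thesis
    unfolding calculus_limit_def
    by (intro exI[of _ "\<lambda>n. pcompose (q n) l"]) (simp add: poly_op_pcompose poly_pcompose[abs_def])
qed

text \<open>Coercivity confines the spectrum to an interval away from 0, where every real power is
  continuous.\<close>

lemma calculus_limit_powr:
  fixes T :: "'a::chilbert_space \<Rightarrow>\<^sub>L 'a"
  assumes "selfadjoint_op T" "0 < c" and "\<And>x. c * (norm x)\<^sup>2 \<le> rinner (T x) x"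
  shows "calculus_limit (\<lambda>t. t powr r) T (T powr\<^sub>L r)"
proof -
  have spectrum: "real_spectrum T \<subseteq> {c..norm T}"
    by (rule real_spectrum_subset[OF assms(3)])
  have "continuous_on {c..norm T} (\<lambda>t. t powr r)"
    using \<open>0 < c\<close> by (auto intro!: continuous_intros)
  then show ?thesis
    using calculus_limit_poly_compose[OF assms(1), of c "norm T" "\<lambda>t. t powr r" "[:0, 1:]"] spectrum
    by (auto simp: poly_op_X powr_op_def subset_iff)
qed

subsection \<open>The scalar inequalities\<close>

text \<open>The tangent line at \<open>m\<close> lies below the convex power function. With u = t /
  m, combine ln u \<le> u - 1, reversed by the factor a \<le> 0, with 1 + x \<le> exp x, then scale
  by \<open>m powr a\<close>.\<close>

lemma powr_tangent_le:
  fixes m t a :: real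
  assumes "0 < m" "0 < t" "a \<le> 0"
  shows "m powr a + a * m powr (a - 1) * (t - m) \<le> t powr a"
proof -
  have "1 + a * (t / m - 1) \<le> 1 + a * ln (t / m)"
    using assms ln_le_minus_one[of "t / m"] by (simp add: mult_left_mono_neg)
  also have "\<dots> \<le> (t / m) powr a"
    using assms exp_ge_add_one_self[of "a * ln (t / m)"] by (simp add: powr_def)
  finally have "m powr a * (1 + a * (t / m - 1)) \<le> m powr a * (t / m) powr a"
    by (rule mult_left_mono) simp
  also have "\<dots> = t powr a"
    using assms by (simp add: powr_divide)
  finally show ?thesis
    using assms by (simp add: powr_diff field_simps)
qed

text \<open>The Hermite--Hadamard inequalities for the convex function \<open>s powr (p - 1)\<close> on \<open>[1, t]\<close>,
  whose integral is \<open>(t powr p - 1) / p\<close>.\<close>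

lemma tsallis_midpoint_le:
  fixes p t :: real
  assumes "0 < p" "p \<le> 1" "1 \<le> t"
  shows "((t + 1) / 2) powr (p - 1) * (t - 1) \<le> (t powr p - 1) / p"
proof -
  let ?h = "\<lambda>t. (t powr p - 1) / p - ((t + 1) / 2) powr (p - 1) * (t - 1)"
  have "?h 1 \<le> ?h t"
  proof (rule DERIV_nonneg_imp_nondecreasing[OF \<open>1 \<le> t\<close>])
    fix s :: real assume "1 \<le> s"
    let ?m = "(s + 1) / 2"
    have "(?h has_real_derivative p * s powr (p - 1) / p -
        ((p - 1) * ?m powr (p - 1 - 1) * (1 / 2) * (s - 1) + ?m powr (p - 1))) (at s)"
      using \<open>1 \<le> s\<close> assms by (auto intro!: derivative_eq_intros)
    \<comment> \<open>The derivative is the gap at \<open>s\<close> above the tangent taken at the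
      midpoint, since \<open>s - ?m\<close> is half of \<open>s - 1\<close>.\<close>
    moreover have "0 \<le> (p * s powr (p - 1)) / p -
        ((p - 1) * ?m powr (p - 1 - 1) * (1 / 2) * (s - 1) + ?m powr (p - 1))"
      using powr_tangent_le[of ?m s "p - 1"] \<open>1 \<le> s\<close> assms by (simp add: field_simps)
    ultimately show "\<exists>y. (?h has_real_derivative y) (at s) \<and> 0 \<le> y" by blast
  qed
  then show ?thesis by simp
qed

lemma tsallis_le_trapezoid:
  fixes p t :: real
  assumes "0 < p" "p \<le> 1" "1 \<le> t"
  shows "(t powr p - 1) / p \<le> 1 / 2 * (t powr p - t powr (p - 1) + t - 1)"
proof -
  let ?h = "\<lambda>t. 1 / 2 * (t powr p - t powr (p - 1) + t - 1) - (t powr p - 1) / p"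
  have "?h 1 \<le> ?h t"
  proof (rule DERIV_nonneg_imp_nondecreasing[OF \<open>1 \<le> t\<close>])
    fix s :: real assume "1 \<le> s"
    have "(?h has_real_derivative 1 / 2 * (p * s powr (p - 1) - (p - 1) * s powr (p - 1 - 1) + 1)
        - (p * s powr (p - 1)) / p) (at s)"
      using \<open>1 \<le> s\<close> assms by (auto intro!: derivative_eq_intros)
    \<comment> \<open>Twice the derivative is the gap at 1 above the tangent taken at
      \<open>s\<close>; this identity expands its slope term.\<close>
    moreover have "s powr (p - 1 - 1) * s = s powr (p - 1)"
      using \<open>1 \<le> s\<close> by (simp add: powr_diff power2_eq_square)
    then have "0 \<le> 1 / 2 * (p * s powr (p - 1) - (p - 1) * s powr (p - 1 - 1) + 1)
        - (p * s powr (p - 1)) / p"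
      using powr_tangent_le[of s 1 "p - 1"] \<open>1 \<le> s\<close> assms by (simp add: algebra_simps)
    ultimately show "\<exists>y. (?h has_real_derivative y) (at s) \<and> 0 \<le> y" by blast
  qed
  then show ?thesis by simp
qed

subsection \<open>Operator inequalities\<close>

lemma loewner_le_sandwich:
  assumes "selfadjoint_op H" "selfadjoint_op X" "selfadjoint_op Y" "positive_op (Y - X)"
  shows "H o\<^sub>L X o\<^sub>L H \<preceq> H o\<^sub>L Y o\<^sub>L H"
  unfolding loewner_le_def
  using assms positive_op_sandwich[of H "Y - X"]
  by (simp add: selfadjoint_op_sandwich blinfun_compose.diff_left blinfun_compose.diff_right)

text \<open>Carries a scalar inequality on the spectrum to the operators, conjugated by
  \<open>H\<close> as in the theorem.\<close>

lemma calculus_limit_loewner_le: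
  fixes T :: "'a::chilbert_space \<Rightarrow>\<^sub>L 'a"
  assumes "selfadjoint_op T" "selfadjoint_op H" "calculus_limit f T X" "calculus_limit g T Y"
    and "\<And>t. t \<in> real_spectrum T \<Longrightarrow> f t \<le> g t"
  shows "H o\<^sub>L X o\<^sub>L H \<preceq> H o\<^sub>L Y o\<^sub>L H"
proof (intro loewner_le_sandwich assms(2))
  show "selfadjoint_op X" "selfadjoint_op Y"
    using assms(3,4) by (auto intro: calculus_limit_selfadjoint[OF assms(1)])
  show "positive_op (Y - X)"
    by (rule calculus_limit_positive[OF assms(1) calculus_limit_diff[OF assms(4,3)]])
      (use assms(5) in simp)
qed

theorem theorem1:
  fixes A B :: "'a::chilbert_space \<Rightarrow>\<^sub>L 'a" and p :: real
  assumes "positive_op A" and "invertible_op A"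
    and "positive_op B" and "invertible_op B"
    and "A \<preceq> B"
    and "0 < p" and "p \<le> 1"
  shows "A powr\<^sub>L (1/2)
           o\<^sub>L ((1/2) *\<^sub>R ((A powr\<^sub>L (-1/2) o\<^sub>L B o\<^sub>L A powr\<^sub>L (-1/2)) + id_blinfun)) powr\<^sub>L (p - 1)
           o\<^sub>L ((A powr\<^sub>L (-1/2) o\<^sub>L B o\<^sub>L A powr\<^sub>L (-1/2)) - id_blinfun)
           o\<^sub>L A powr\<^sub>L (1/2)
         \<preceq> tsallis_op p A B
       \<and> tsallis_op p A B
         \<preceq> (1/2) *\<^sub>R (geometric_mean_op p A B - natural_op (p - 1) A B + B - A)"
proof -
  define H where "H = A powr\<^sub>L (1/2)"
  define G where "G = A powr\<^sub>L (-1/2)"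
  define C where "C = G o\<^sub>L B o\<^sub>L G"
  define D where "D = (1/2) *\<^sub>R (C + id_blinfun)"
  have A: "selfadjoint_op A" and B: "selfadjoint_op B"
    using assms by (auto simp: positive_op_iff)
  obtain c where c: "0 < c" "\<And>x. c * (norm x)\<^sup>2 \<le> rinner (A x) x"
    using positive_invertible_coercive assms(1,2) by blast
  have spec_A: "0 < t" if "t \<in> real_spectrum A" for t
    using real_spectrum_subset[OF c(2)] that c(1) by auto
  have powr_A: "calculus_limit (\<lambda>t. t powr r) A (A powr\<^sub>L r)" for r
    by (rule calculus_limit_powr[OF A c])
  have compose_powr_A: "calculus_limit (\<lambda>t. t powr (r + s)) A (A powr\<^sub>L r o\<^sub>L A powr\<^sub>L s)" for r s
    using calculus_limit_mult[OF powr_A powr_A] by (simp add: powr_add)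
  have H: "selfadjoint_op H" and G: "selfadjoint_op G"
    unfolding H_def G_def by (auto intro: calculus_limit_selfadjoint[OF A powr_A])
  \<comment> \<open>The exponents add up to 1, and \<open>t powr 1\<close> is \<open>t\<close> on
    the positive spectrum.\<close>
  have "calculus_limit (\<lambda>t. t) A (H o\<^sub>L H)"
    unfolding H_def by (rule calculus_limit_cong[OF compose_powr_A]) (simp add: spec_A less_imp_le)
  then have HH: "H o\<^sub>L H = A"
    using calculus_limit_unique[OF A _ calculus_limit_id] by blast
  \<comment> \<open>Since \<open>0 powr 0 = 0\<close>, the spectrum must avoid 0 for this power to
    be the constant 1.\<close>
  have one: "S = id_blinfun" if "calculus_limit (\<lambda>t. t powr 0) A S" for S
  proof (rule calculus_limit_unique[OF A])
    show "calculus_limit (\<lambda>t. 1) A S"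
      by (rule calculus_limit_cong[OF that]) (use spec_A in force)
    show "calculus_limit (\<lambda>t. 1) A id_blinfun"
      using calculus_limit_const[of 1 A] by simp
  qed
  have HG: "H o\<^sub>L G = id_blinfun" and GH: "G o\<^sub>L H = id_blinfun"
    using one compose_powr_A[of "1/2" "-1/2"] compose_powr_A[of "-1/2" "1/2"]
    by (auto simp: H_def G_def)
  have C: "selfadjoint_op C"
    unfolding C_def by (rule selfadjoint_op_sandwich[OF G B])
  \<comment> \<open>Conjugating A \<le> B by \<open>G\<close> gives I = G A G \<le> C.\<close>
  have C_ge: "1 * (norm x)\<^sup>2 \<le> rinner (C x) x" for x
  proof -
    have "A o\<^sub>L G = H"
      using HG by (metis HH blinfun_compose_assoc blinfun_compose_id(2))
    then have "rinner (A (G x)) (G x) = rinner ((G o\<^sub>L H) x) x"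
      by (metis G blinfun_apply_blinfun_compose selfadjoint_op_rinner)
    moreover have "rinner (A (G x)) (G x) \<le> rinner (B (G x)) (G x)"
      using \<open>A \<preceq> B\<close>
      by (simp add: loewner_le_def positive_op_iff blinfun.bilinear_simps rinner.diff_left)
    moreover have "rinner (B (G x)) (G x) = rinner (C x) x"
      using G by (simp add: C_def selfadjoint_op_rinner)
    ultimately show ?thesis by (simp add: GH rinner_self)
  qed
  have spec_C: "real_spectrum C \<subseteq> {1..norm C}"
    by (rule real_spectrum_subset[OF C_ge])
  have powr_C: "calculus_limit (\<lambda>t. t powr r) C (C powr\<^sub>L r)" for r
    by (rule calculus_limit_powr[OF C _ C_ge]) simp
  let ?l = "[:1/2, 1/2:] :: real poly"
  have D: "D = poly_op ?l C"
    by (simp add: D_def poly_op_pCons poly_op_0 blinfun_compose.scaleR_right scaleR_right_distrib)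
  have "real_spectrum D \<subseteq> {1..norm D}"
    using C_ge by (intro real_spectrum_subset)
      (simp add: D_def blinfun.bilinear_simps rinner_add_left rinner_scaleR_left rinner_self)
  \<comment> \<open>The power of \<open>D\<close> is expressed as a function of \<open>C\<close>.
    The interval must contain the spectrum of \<open>D\<close> and the values (t + 1) / 2 on that of
    \<open>C\<close>, which lie between 1 and \<open>t\<close>; hence the maximum of the two
    norms.\<close>
  then have "calculus_limit (\<lambda>t. poly ?l t powr (p - 1)) C (D powr\<^sub>L (p - 1))"
    unfolding powr_op_def D using spec_C
    by (intro calculus_limit_poly_compose[OF C, of 1 "max (norm D) (norm C)"])
      (fastforce intro!: continuous_intros simp: D)+
  then have powr_D: "calculus_limit (\<lambda>t. ((t + 1) / 2) powr (p - 1)) C (D powr\<^sub>L (p - 1))"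
    by (simp add: add_divide_distrib add.commute)
  note calculus_limits = calculus_limit_mult calculus_limit_diff calculus_limit_add calculus_limit_id
    calculus_limit_scaleR powr_C powr_D
  have id_C: "calculus_limit (\<lambda>t. 1) C id_blinfun"
    using calculus_limit_const[of 1 C] by simp
  have X: "calculus_limit (\<lambda>t. ((t + 1) / 2) powr (p - 1) * (t - 1)) C
      (D powr\<^sub>L (p - 1) o\<^sub>L (C - id_blinfun))"
    by (intro calculus_limits id_C)
  have Y: "calculus_limit (\<lambda>t. (1 / p) * (t powr p - 1)) C ((1 / p) *\<^sub>R (C powr\<^sub>L p - id_blinfun))"
    by (intro calculus_limits id_C)
  have Z: "calculus_limit (\<lambda>t. 1 / 2 * (t powr p - t powr (p - 1) + t - 1)) C
      ((1/2) *\<^sub>R (C powr\<^sub>L p - C powr\<^sub>L (p - 1) + C - id_blinfun))"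
    by (intro calculus_limits id_C)
  have XY: "H o\<^sub>L (D powr\<^sub>L (p - 1) o\<^sub>L (C - id_blinfun)) o\<^sub>L H \<preceq>
      H o\<^sub>L ((1 / p) *\<^sub>R (C powr\<^sub>L p - id_blinfun)) o\<^sub>L H"
    by (rule calculus_limit_loewner_le[OF C H X Y])
      (use spec_C tsallis_midpoint_le[OF assms(6,7)] in auto)
  have YZ: "H o\<^sub>L ((1 / p) *\<^sub>R (C powr\<^sub>L p - id_blinfun)) o\<^sub>L H \<preceq>
      H o\<^sub>L ((1/2) *\<^sub>R (C powr\<^sub>L p - C powr\<^sub>L (p - 1) + C - id_blinfun)) o\<^sub>L H"
    by (rule calculus_limit_loewner_le[OF C H Y Z])
      (use spec_C tsallis_le_trapezoid[OF assms(6,7)] in auto)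
  \<comment> \<open>The outer factors cancel: H (G B G) H = B, because \<open>G\<close> inverts
    \<open>H\<close>.\<close>
  have HCH: "H o\<^sub>L C o\<^sub>L H = B"
    unfolding C_def by (metis GH HG blinfun_compose_assoc blinfun_compose_id)
  have natural: "natural_op r A B = H o\<^sub>L C powr\<^sub>L r o\<^sub>L H" for r
    by (simp add: natural_op_def H_def G_def C_def)
  have tsallis: "tsallis_op p A B = H o\<^sub>L ((1 / p) *\<^sub>R (C powr\<^sub>L p - id_blinfun)) o\<^sub>L H"
    by (simp add: tsallis_op_def natural HH blinfun_compose.diff_left blinfun_compose.diff_right
        blinfun_compose.scaleR_left blinfun_compose.scaleR_right)
  have upper: "(1/2) *\<^sub>R (natural_op p A B - natural_op (p - 1) A B + B - A) =
      H o\<^sub>L ((1/2) *\<^sub>R (C powr\<^sub>L p - C powr\<^sub>L (p - 1) + C - id_blinfun)) o\<^sub>L H"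
    by (simp add: natural HH HCH blinfun_compose.diff_left blinfun_compose.diff_right
        blinfun_compose.add_left blinfun_compose.add_right
        blinfun_compose.scaleR_left blinfun_compose.scaleR_right)
  show ?thesis
    using XY YZ unfolding tsallis upper
    unfolding H_def[symmetric] G_def[symmetric] C_def[symmetric] D_def[symmetric]
    by (simp add: blinfun_compose_assoc)
qed

end
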